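(* Let $\mathbb{K}$ be a field of characteristic not $2$. (1) Let $\mathcal{L}=(\mathcal{L},[-,-],\alpha)$ be a Hom-Lie algebra over $\mathbb{K}$, and let $\kappa,\lambda$ be linear endomorphisms of $\mathcal{L}$ satisfying $\lambda\alpha=\alpha\lambda$ and $\kappa\alpha=\alpha\kappa$, such that for all $a,b\in\mathcal{L}$, $$\lambda([a,b])=[\lambda(a),\alpha(b)]-[\alpha(a),\kappa(b)]+[\alpha(a),\lambda(b)].\qquad( * )$$ Then, for any $r\in\mathcal{L}$, the affine space $\mathcal{L}$ with the operations $\langle a,b,c\rangle=a-b+c$ and $\xi\blacktriangleright_a b=\xi b+(1-\xi)a$ ($a,b,c\in\mathcal{L}$, $\xi\in\mathbb{K}$), equipped with the same unary map $\alpha$ and the affine bracket $$\{a,b\}=[a,b]+\kappa(a)+\lambda(b-a)+r\qquad(a,b\in\mathcal{L}),$$ forms a multiplicative Hom-Lie affgebra, denoted $\mathcal{A}(\mathcal{L};\alpha,\kappa,\lambda,r)$. Moreover, for every $o\in\mathcal{A}(\mathcal{L};\alpha,\kappa,\lambda,r)$ satisfying $\alpha(o)=o$, one has $T_o\mathcal{A}(\mathcal{L};\alpha,\kappa,\lambda,r)\cong\mathcal{L}$ as Hom-Lie algebras. (2) Conversely, for any multiplicative Hom-Lie affgebra $(\mathcal{A},\{-,-\},\alpha)$ over $\mathbb{K}$ and any $o\in\mathcal{A}$ such that $\alpha(o)=o$, there exist linear maps $\kappa,\lambda:T_o\mathcal{A}\to T_o\mathcal{A}$, necessarily satisfying $(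 * )$ for the Hom-Lie algebra $T_o\mathcal{A}$, and an element $r\in T_o\mathcal{A}$, such that $\mathcal{A}=\mathcal{A}(T_o\mathcal{A};\alpha,\kappa,\lambda,r)$.
   Context: An abelian heap is a set $\mathcal{A}$ with a ternary operation $\langle-,-,-\rangle$ satisfying $\langle\langle a,b,c\rangle,d,e\rangle=\langle a,b,\langle c,d,e\rangle\rangle$, $\langle a,a,b\rangle=b=\langle b,a,a\rangle$ and $\langle a,b,c\rangle=\langle c,b,a\rangle$; $\langle a_1,\dots,a_{2n+1}\rangle$ denotes any iterated application of the operation (the result does not depend on bracketing). An affine space over $\mathbb{K}$ is a non-empty abelian heap $\mathcal{A}$ with an action $\mathbb{K}\times\mathcal{A}\times\mathcal{A}\to\mathcal{A}$, $(\xi,a,b)\mapsto\xi\blacktriangleright_a b$, such that: $\xi\blacktriangleright_a-$ and $-\blacktriangleright_a b$ are heap homomorphisms ($\mathbb{K}$ being a heap via $\xi-\zeta+\gamma$); $(\xi\zeta)\blacktriangleright_a b=\xi\blacktriangleright_a(\zeta\blacktriangleright_a b)$; $\xi\blacktriangleright_a b=\langle\xi\blacktriangleright_c b,\xi\blacktriangleright_c a,a\rangle$; $0\blacktriangleright_a b=a$, $1\blacktriangleright_a b=b$. An affine map is a heap homomorphism $f$ with $f(\xi\blacktriangleright_a b)=\xi\blacktriangleright_{f(a)}f(b)$. A map $\mathcal{A}\times\mathcal{A}\to\mathcal{A}$ is bi-affine if it is affine in each argument. For $o\in\mathcal{A}$, the fibre (tangent space) $T_o\mathcal{A}$ is the vector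 space with underlying set $\mathcal{A}$, addition $a+b=\langle a,o,b\rangle$, scalar multiplication $\xi a=\xi\blacktriangleright_o a$, and zero $o$. A Hom-Lie affgebra is a triple $(\mathcal{A},\{-,-\},\alpha)$ with $\mathcal{A}$ an affine space, $\{-,-\}:\mathcal{A}\times\mathcal{A}\to\mathcal{A}$ bi-affine and $\alpha:\mathcal{A}\to\mathcal{A}$ affine, such that for all $a,b,c$: $\langle\{a,b\},\{a,a\},\{b,a\}\rangle=\{b,b\}$ and $\langle\{\alpha(a),\{b,c\}\},\{\alpha(a),\{a,a\}\},\{\alpha(b),\{c,a\}\},\{\alpha(b),\{b,b\}\},\{\alpha(c),\{a,b\}\}\rangle=\{\alpha(c),\{c,c\}\}$. It is multiplicative if $\alpha\{a,b\}=\{\alpha(a),\alpha(b)\}$ for all $a,b$. A Hom-Lie algebra is a vector space $\mathcal{L}$ with a skew-symmetric bilinear bracket $[-,-]$ and a linear map $\alpha$ such that $[\alpha(a),[b,c]]+[\alpha(b),[c,a]]+[\alpha(c),[a,b]]=0$. An isomorphism of Hom-Lie algebras is a linear bijection preserving brackets and intertwining the twisting maps. For a Hom-Lie affgebra $(\mathcal{A},\{-,-\},\alpha)$ and $o\in\mathcal{A}$ with $\alpha(o)=o$, the fibre $T_o\mathcal{A}$ is regarded as a Hom-Lie algebra with twisting map $\alpha$ and bracket $[a,b]_o=\langle\{a,b\},\{a,o\},\{o,o\},\{o,b\},o\rangle$.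
   Formalization: In (1), "multiplicative" is claimed only when α[a,b]=[α(a),α(b)] for all a,b and α(r)=r; it fails otherwise, e.g. L=K with zero bracket, α=κ=λ=0, r=1. The Hom-Lie affgebra and isomorphism claims stay unrestricted. *)

theory Defs
  imports "Jordan_Normal_Form.Missing_VectorSpace"
begin

section \<open>Abelian heaps and affine spaces\<close>

record 'a heap = "'a partial_object" +
  tern :: "'a \<Rightarrow> 'a \<Rightarrow> 'a \<Rightarrow> 'a"

record ('k, 'a) affine = "'a heap" +
  act :: "'k \<Rightarrow> 'a \<Rightarrow> 'a \<Rightarrow> 'a"  \<comment> \<open>\<open>act A \<xi> a b\<close> is the action of \<open>\<xi>\<close> on \<open>b\<close> based at \<open>a\<close>\<close>

abbreviation tern5 :: "('a, 'm) heap_scheme \<Rightarrow> 'a \<Rightarrow> 'a \<Rightarrow> 'a \<Rightarrow> 'a \<Rightarrow> 'a \<Rightarrow> 'a"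
  where "tern5 A a b c d e \<equiv> tern A (tern A a b c) d e"

locale abelian_heap =
  fixes A :: "('a, 'm) heap_scheme"
  assumes tern_closed:
      "\<lbrakk>a \<in> carrier A; b \<in> carrier A; c \<in> carrier A\<rbrakk> \<Longrightarrow> tern A a b c \<in> carrier A"
    and tern_assoc:
      "\<lbrakk>a \<in> carrier A; b \<in> carrier A; c \<in> carrier A; d \<in> carrier A; e \<in> carrier A\<rbrakk> \<Longrightarrow>
        tern A (tern A a b c) d e = tern A a b (tern A c d e)"
    and tern_left_cancel: "\<lbrakk>a \<in> carrier A; b \<in> carrier A\<rbrakk> \<Longrightarrow> tern A a a b = b"
    and tern_right_cancel: "\<lbrakk>a \<in> carrier A; b \<in> carrier A\<rbrakk> \<Longrightarrow> tern A b a a = b"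
    and tern_comm:
      "\<lbrakk>a \<in> carrier A; b \<in> carrier A; c \<in> carrier A\<rbrakk> \<Longrightarrow> tern A a b c = tern A c b a"

definition heap_hom :: "('a, 'm) heap_scheme \<Rightarrow> ('b, 'n) heap_scheme \<Rightarrow> ('a \<Rightarrow> 'b) set"
  where "heap_hom A B = {f \<in> carrier A \<rightarrow> carrier B.
    \<forall>a\<in>carrier A. \<forall>b\<in>carrier A. \<forall>c\<in>carrier A. f (tern A a b c) = tern B (f a) (f b) (f c)}"

definition group_heap :: "('a, 'm) ring_scheme \<Rightarrow> 'a heap"
  where "group_heap G = \<lparr>carrier = carrier G, tern = (\<lambda>a b c. (a \<ominus>\<^bsub>G\<^esub> b) \<oplus>\<^bsub>G\<^esub> c)\<rparr>"

locale affine_space = field K + abelian_heap A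
  for K :: "('k, 'r) ring_scheme" (structure) and A :: "('k, 'a, 'm) affine_scheme" +
  assumes nonempty: "carrier A \<noteq> {}"
    and act_hom:
      "\<lbrakk>\<xi> \<in> carrier K; a \<in> carrier A\<rbrakk> \<Longrightarrow> act A \<xi> a \<in> heap_hom A A"
    and act_hom_scalar:
      "\<lbrakk>a \<in> carrier A; b \<in> carrier A\<rbrakk> \<Longrightarrow> (\<lambda>\<xi>. act A \<xi> a b) \<in> heap_hom (group_heap K) A"
    and act_mult:
      "\<lbrakk>\<xi> \<in> carrier K; \<zeta> \<in> carrier K; a \<in> carrier A; b \<in> carrier A\<rbrakk> \<Longrightarrow>
        act A (\<xi> \<otimes> \<zeta>) a b = act A \<xi> a (act A \<zeta> a b)"
    and act_base_change:
      "\<lbrakk>\<xi> \<in> carrier K; a \<in> carrier A; b \<in> carrier A; c \<in> carrier A\<rbrakk> \<Longrightarrow>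
        act A \<xi> a b = tern A (act A \<xi> c b) (act A \<xi> c a) a"
    and act_zero: "\<lbrakk>a \<in> carrier A; b \<in> carrier A\<rbrakk> \<Longrightarrow> act A \<zero> a b = a"
    and act_one: "\<lbrakk>a \<in> carrier A; b \<in> carrier A\<rbrakk> \<Longrightarrow> act A \<one> a b = b"

definition affine_maps ::
  "('k, 'r) ring_scheme \<Rightarrow> ('k, 'a, 'm) affine_scheme \<Rightarrow> ('k, 'b, 'n) affine_scheme \<Rightarrow> ('a \<Rightarrow> 'b) set"
  where "affine_maps K A B = {f \<in> heap_hom A B.
    \<forall>\<xi>\<in>carrier K. \<forall>a\<in>carrier A. \<forall>b\<in>carrier A. f (act A \<xi> a b) = act B \<xi> (f a) (f b)}"


section \<open>Hom-Lie algebras\<close>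

record ('k, 'a) hom_lie = "('k, 'a) module" +
  lie_br :: "'a \<Rightarrow> 'a \<Rightarrow> 'a"
  lie_tw :: "'a \<Rightarrow> 'a"

locale hom_lie_algebra = vectorspace K L
  for K :: "('k, 'r) ring_scheme" and L :: "('k, 'a, 'm) hom_lie_scheme" (structure) +
  assumes br_linear_left: "b \<in> carrier L \<Longrightarrow> linear_map K L L (\<lambda>a. lie_br L a b)"
    and br_linear_right: "a \<in> carrier L \<Longrightarrow> linear_map K L L (lie_br L a)"
    and br_skew: "\<lbrakk>a \<in> carrier L; b \<in> carrier L\<rbrakk> \<Longrightarrow> lie_br L a b = \<ominus> lie_br L b a"
    and tw_linear: "linear_map K L L (lie_tw L)"
    and hom_jacobi:
      "\<lbrakk>a \<in> carrier L; b \<in> carrier L; c \<in> carrier L\<rbrakk> \<Longrightarrow>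
        lie_br L (lie_tw L a) (lie_br L b c) \<oplus> lie_br L (lie_tw L b) (lie_br L c a)
          \<oplus> lie_br L (lie_tw L c) (lie_br L a b) = \<zero>"

definition hom_lie_iso ::
  "('k, 'r) ring_scheme \<Rightarrow> ('k, 'a, 'm) hom_lie_scheme \<Rightarrow> ('k, 'b, 'n) hom_lie_scheme \<Rightarrow> bool"
  where "hom_lie_iso K L M \<longleftrightarrow> hom_lie_algebra K L \<and> hom_lie_algebra K M \<and>
    (\<exists>f. linear_map K L M f \<and> bij_betw f (carrier L) (carrier M) \<and>
      (\<forall>a\<in>carrier L. \<forall>b\<in>carrier L. f (lie_br L a b) = lie_br M (f a) (f b)) \<and>
      (\<forall>a\<in>carrier L. f (lie_tw L a) = lie_tw M (f a)))"

text \<open>Not part of the definition of a Hom-Lie algebra; it enters because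
  \<open>affgebra_of K L \<kappa> lam r\<close> below can only be multiplicative if the twisting map of
  \<open>L\<close> is multiplicative and fixes \<open>r\<close> (put \<open>a = b = \<zero>\<close> in the bracket to see
  the latter).\<close>

definition tw_multiplicative :: "('k, 'a, 'm) hom_lie_scheme \<Rightarrow> bool"
  where "tw_multiplicative L \<longleftrightarrow> (\<forall>a\<in>carrier L. \<forall>b\<in>carrier L.
    lie_tw L (lie_br L a b) = lie_br L (lie_tw L a) (lie_tw L b))"


section \<open>Hom-Lie affgebras\<close>

record ('k, 'a) hom_lie_aff = "('k, 'a) affine" +
  aff_br :: "'a \<Rightarrow> 'a \<Rightarrow> 'a"
  aff_tw :: "'a \<Rightarrow> 'a"

locale hom_lie_affgebra = affine_space K A
  for K :: "('k, 'r) ring_scheme" and A :: "('k, 'a, 'm) hom_lie_aff_scheme" +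
  assumes br_affine_left: "b \<in> carrier A \<Longrightarrow> (\<lambda>a. aff_br A a b) \<in> affine_maps K A A"
    and br_affine_right: "a \<in> carrier A \<Longrightarrow> aff_br A a \<in> affine_maps K A A"
    and tw_affine: "aff_tw A \<in> affine_maps K A A"
    and aff_antisymmetry:
      "\<lbrakk>a \<in> carrier A; b \<in> carrier A\<rbrakk> \<Longrightarrow>
        tern A (aff_br A a b) (aff_br A a a) (aff_br A b a) = aff_br A b b"
    and aff_hom_jacobi:
      "\<lbrakk>a \<in> carrier A; b \<in> carrier A; c \<in> carrier A\<rbrakk> \<Longrightarrow>
        tern5 A (aff_br A (aff_tw A a) (aff_br A b c)) (aff_br A (aff_tw A a) (aff_br A a a))
                (aff_br A (aff_tw A b) (aff_br A c a)) (aff_br A (aff_tw A b) (aff_br A b b))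
                (aff_br A (aff_tw A c) (aff_br A a b))
        = aff_br A (aff_tw A c) (aff_br A c c)"

locale multiplicative_hom_lie_affgebra = hom_lie_affgebra K A
  for K :: "('k, 'r) ring_scheme" and A :: "('k, 'a, 'm) hom_lie_aff_scheme" +
  assumes tw_mult:
      "\<lbrakk>a \<in> carrier A; b \<in> carrier A\<rbrakk> \<Longrightarrow>
        aff_tw A (aff_br A a b) = aff_br A (aff_tw A a) (aff_tw A b)"

text \<open>Equality of Hom-Lie affgebras, insensitive to the values of the operations outside the
  carrier.\<close>

definition same_hom_lie_affgebra ::
  "('k, 'r) ring_scheme \<Rightarrow> ('k, 'a, 'm) hom_lie_aff_scheme \<Rightarrow> ('k, 'a, 'n) hom_lie_aff_scheme \<Rightarrow> bool"
  where "same_hom_lie_affgebra K A B \<longleftrightarrow> carrier A = carrier B \<and>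
    (\<forall>a\<in>carrier A. \<forall>b\<in>carrier A. \<forall>c\<in>carrier A. tern A a b c = tern B a b c) \<and>
    (\<forall>\<xi>\<in>carrier K. \<forall>a\<in>carrier A. \<forall>b\<in>carrier A. act A \<xi> a b = act B \<xi> a b) \<and>
    (\<forall>a\<in>carrier A. \<forall>b\<in>carrier A. aff_br A a b = aff_br B a b) \<and>
    (\<forall>a\<in>carrier A. aff_tw A a = aff_tw B a)"

text \<open>The fibre at \<open>u\<close>. The fields \<open>mult\<close> and \<open>one\<close> belong to the ring part of the
  module record and play no role in the vector space structure. The last argument of the
  bracket's heap operation restores the zero \<open>u\<close> of the fibre.\<close>

definition fibre :: "('k, 'a, 'm) hom_lie_aff_scheme \<Rightarrow> 'a \<Rightarrow> ('k, 'a) hom_lie"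
  where "fibre A u =
    \<lparr>carrier = carrier A, mult = undefined, one = undefined,
     zero = u, add = (\<lambda>a b. tern A a u b), smult = (\<lambda>\<xi> a. act A \<xi> u a),
     lie_br = (\<lambda>a b. tern5 A (aff_br A a b) (aff_br A a u) (aff_br A u u) (aff_br A u b) u),
     lie_tw = aff_tw A\<rparr>"


section \<open>The Hom-Lie affgebra of a Hom-Lie algebra\<close>

definition lie_compatible :: "('k, 'a, 'm) hom_lie_scheme \<Rightarrow> ('a \<Rightarrow> 'a) \<Rightarrow> ('a \<Rightarrow> 'a) \<Rightarrow> bool"
  where "lie_compatible L \<kappa> lam \<longleftrightarrow> (\<forall>a\<in>carrier L. \<forall>b\<in>carrier L.
    lam (lie_br L a b) =
      (lie_br L (lam a) (lie_tw L b) \<ominus>\<^bsub>L\<^esub> lie_br L (lie_tw L a) (\<kappa> b))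
        \<oplus>\<^bsub>L\<^esub> lie_br L (lie_tw L a) (lam b))"

definition commutes_with_twist :: "('k, 'a, 'm) hom_lie_scheme \<Rightarrow> ('a \<Rightarrow> 'a) \<Rightarrow> bool"
  where "commutes_with_twist L f \<longleftrightarrow> (\<forall>a\<in>carrier L. f (lie_tw L a) = lie_tw L (f a))"

definition affgebra_of ::
  "('k, 'r) ring_scheme \<Rightarrow> ('k, 'a, 'm) hom_lie_scheme \<Rightarrow> ('a \<Rightarrow> 'a) \<Rightarrow> ('a \<Rightarrow> 'a) \<Rightarrow> 'a
    \<Rightarrow> ('k, 'a) hom_lie_aff"
  where "affgebra_of K L \<kappa> lam r =
    \<lparr>carrier = carrier L,
     tern = (\<lambda>a b c. (a \<ominus>\<^bsub>L\<^esub> b) \<oplus>\<^bsub>L\<^esub> c),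
     act = (\<lambda>\<xi> a b. (\<xi> \<odot>\<^bsub>L\<^esub> b) \<oplus>\<^bsub>L\<^esub> ((\<one>\<^bsub>K\<^esub> \<ominus>\<^bsub>K\<^esub> \<xi>) \<odot>\<^bsub>L\<^esub> a)),
     aff_br = (\<lambda>a b. ((lie_br L a b \<oplus>\<^bsub>L\<^esub> \<kappa> a) \<oplus>\<^bsub>L\<^esub> lam (b \<ominus>\<^bsub>L\<^esub> a)) \<oplus>\<^bsub>L\<^esub> r),
     aff_tw = lie_tw L\<rparr>"

end

theory Submission
  imports Defs
begin

text \<open>
  Once a point \<open>u\<close> of an affine space \<open>A\<close> is chosen as origin, the affine structure is that of the
  vector space \<open>T\<^sub>u A\<close>: the heap operation is \<open>a - b + c\<close>, the action is \<open>a + \<xi> (b - a)\<close>, and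
  a map is affine exactly if it is linear up to a constant (\<open>fibre_vectorises\<close>, \<open>linear_part\<close>,
  \<open>affine_mapI\<close>). Hence a bi-affine bracket is the sum of a bilinear map, a linear map of each
  argument and a constant. The bilinear part is the bracket of the fibre, and the other parts can
  be named so that \<open>{a,b} = [a,b] + \<kappa> a + \<lambda> (b - a) + r\<close>. If \<open>u\<close> is fixed by the twisting map
  \<open>\<alpha>\<close>, then \<open>\<alpha>\<close> is linear on \<open>T\<^sub>u A\<close>. So every affgebra with a fixed point has the required
  shape for some linear \<open>\<kappa>, \<lambda>\<close> and some \<open>r\<close> (\<open>fibre_presentation\<close>), and both halves of the
  theorem reduce to the question which data \<open>[-,-], \<alpha>, \<kappa>, \<lambda>, r\<close> produce a Hom-Lie affgebra.

  That question has an answer in both directions, \<open>hom_lie_affgebra_iff\<close>. The affine antisymmetry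
  reads \<open>[a,b] + [b,a] = [a,a] + [b,b]\<close>, which for a bilinear bracket means \<open>[a,a] = 0\<close>; away from
  characteristic 2 this is skew symmetry. Given it, the affine Hom-Jacobi identity becomes
  \<open>J(a,b,c) + D(a,b) + D(b,c) + D(c,a) - D(a,a) - D(b,b) - D(c,c) = 0\<close> (\<open>increment_sum\<close>),
  where \<open>J\<close> is the Hom-Jacobi sum of the bracket and \<open>D(a,b)\<close> the difference of the two sides of
  the compatibility condition. It holds if \<open>J\<close> and \<open>D\<close> vanish. Conversely, \<open>J\<close> and \<open>D\<close> vanish
  whenever one argument is zero, so \<open>(a,0,0)\<close> gives \<open>D(a,a) = 0\<close>, then \<open>(a,b,0)\<close> gives
  \<open>D(a,b) = 0\<close>, and what remains is \<open>J = 0\<close>. Multiplicativity is read off in the same way from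
  the arguments \<open>(0,0)\<close>, \<open>(0,b)\<close>, \<open>(a,0)\<close> and \<open>(a,b)\<close> (\<open>multiplicative_iff\<close>).

  If the affgebra is built from a Hom-Lie algebra \<open>L\<close>, the isomorphism \<open>T\<^sub>u A \<rightarrow> L\<close> is the
  translation \<open>a \<mapsto> a - u\<close>: the terms in \<open>\<kappa>\<close>, \<open>\<lambda>\<close> and \<open>r\<close> cancel in the bracket of the fibre,
  which is \<open>[a - u, b - u] + u\<close> (\<open>fibre_iso\<close>).
\<close>

section \<open>Calculating in abelian groups and vector spaces\<close>

context abelian_group
begin

lemma add_diff_eq:
  "\<lbrakk>a \<in> carrier G; b \<in> carrier G; c \<in> carrier G\<rbrakk> \<Longrightarrow> a \<oplus> (b \<ominus> c) = (a \<oplus> b) \<ominus> c"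
  by (simp add: minus_eq a_ac)

lemma diff_add_eq:
  "\<lbrakk>a \<in> carrier G; b \<in> carrier G; c \<in> carrier G\<rbrakk> \<Longrightarrow> (a \<ominus> b) \<oplus> c = (a \<oplus> c) \<ominus> b"
  by (simp add: minus_eq a_ac)

lemma diff_diff_left:
  "\<lbrakk>a \<in> carrier G; b \<in> carrier G; c \<in> carrier G\<rbrakk> \<Longrightarrow> (a \<ominus> b) \<ominus> c = a \<ominus> (b \<oplus> c)"
  by (simp add: minus_eq a_ac minus_add)

lemma diff_diff_right:
  "\<lbrakk>a \<in> carrier G; b \<in> carrier G; c \<in> carrier G\<rbrakk> \<Longrightarrow> a \<ominus> (b \<ominus> c) = (a \<oplus> c) \<ominus> b"
  by (simp add: minus_eq a_ac minus_add)

lemma diff_eq_eq: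
  "\<lbrakk>a \<in> carrier G; b \<in> carrier G; c \<in> carrier G\<rbrakk> \<Longrightarrow> (a \<ominus> b = c) = (a = c \<oplus> b)"
  by (metis add.inv_solve_right minus_eq)

lemma eq_diff_eq:
  "\<lbrakk>a \<in> carrier G; b \<in> carrier G; c \<in> carrier G\<rbrakk> \<Longrightarrow> (c = a \<ominus> b) = (c \<oplus> b = a)"
  by (metis diff_eq_eq)

lemma inv_eq_zero_diff: "a \<in> carrier G \<Longrightarrow> \<ominus> a = \<zero> \<ominus> a"
  by (simp add: minus_eq)

lemma diff_zero: "a \<in> carrier G \<Longrightarrow> a \<ominus> \<zero> = a"
  by (simp add: diff_eq_eq)

text \<open>
  Differences are moved outwards and across equations until both sides are sums without
  subtraction, which associativity and commutativity then compare. Cancelling terms never have to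
  be brought next to each other, which ordered rewriting of sums with inverses would require.
\<close>

lemmas group_simps = add_diff_eq diff_add_eq diff_diff_left diff_diff_right
  diff_eq_eq eq_diff_eq inv_eq_zero_diff a_ac

end

context module
begin

lemma smult_diff_right:
  "\<lbrakk>\<xi> \<in> carrier R; x \<in> carrier M; y \<in> carrier M\<rbrakk> \<Longrightarrow> \<xi> \<odot>\<^bsub>M\<^esub> (x \<ominus>\<^bsub>M\<^esub> y) = \<xi> \<odot>\<^bsub>M\<^esub> x \<ominus>\<^bsub>M\<^esub> \<xi> \<odot>\<^bsub>M\<^esub> y"
  by (simp add: M.minus_eq smult_r_distr smult_r_minus)

lemma smult_diff_left:
  "\<lbrakk>\<xi> \<in> carrier R; \<zeta> \<in> carrier R; x \<in> carrier M\<rbrakk> \<Longrightarrow> (\<xi> \<ominus> \<zeta>) \<odot>\<^bsub>M\<^esub> x = \<xi> \<odot>\<^bsub>M\<^esub> x \<ominus>\<^bsub>M\<^esub> \<zeta> \<odot>\<^bsub>M\<^esub> x"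
  by (simp add: M.minus_eq R.minus_eq smult_l_distr smult_l_minus)

lemmas smult_simps = smult_r_distr smult_l_distr smult_diff_right smult_diff_left smult_assoc1

end

lemma linear_mapI:
  assumes "vectorspace K V" "vectorspace K W"
    and "\<And>x. x \<in> carrier V \<Longrightarrow> f x \<in> carrier W"
    and "\<And>x y. \<lbrakk>x \<in> carrier V; y \<in> carrier V\<rbrakk> \<Longrightarrow> f (x \<oplus>\<^bsub>V\<^esub> y) = f x \<oplus>\<^bsub>W\<^esub> f y"
    and "\<And>\<xi> x. \<lbrakk>\<xi> \<in> carrier K; x \<in> carrier V\<rbrakk> \<Longrightarrow> f (\<xi> \<odot>\<^bsub>V\<^esub> x) = \<xi> \<odot>\<^bsub>W\<^esub> f x"
  shows "linear_map K V W f"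
  using assms
  by (auto simp: linear_map_def mod_hom_def mod_hom_axioms_def module_hom_def vectorspace_def)

context linear_map
begin

lemma f_diff:
  assumes "x \<in> carrier V" "y \<in> carrier V"
  shows "T (x \<ominus>\<^bsub>V\<^esub> y) = T x \<ominus>\<^bsub>W\<^esub> T y"
proof -
  have "x = (x \<ominus>\<^bsub>V\<^esub> y) \<oplus>\<^bsub>V\<^esub> y"
    using assms by (simp add: V.module.M.group_simps)
  then have "T x = T (x \<ominus>\<^bsub>V\<^esub> y) \<oplus>\<^bsub>W\<^esub> T y"
    using assms by (metis f_add V.module.M.minus_closed)
  then show ?thesis
    using assms by (simp add: W.module.M.eq_diff_eq)
qed

end

lemma linear_mapD:
  assumes "linear_map K V W f"
  shows "x \<in> carrier V \<Longrightarrow> f x \<in> carrier W"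
    and "\<lbrakk>x \<in> carrier V; y \<in> carrier V\<rbrakk> \<Longrightarrow> f (x \<oplus>\<^bsub>V\<^esub> y) = f x \<oplus>\<^bsub>W\<^esub> f y"
    and "\<lbrakk>x \<in> carrier V; y \<in> carrier V\<rbrakk> \<Longrightarrow> f (x \<ominus>\<^bsub>V\<^esub> y) = f x \<ominus>\<^bsub>W\<^esub> f y"
    and "f \<zero>\<^bsub>V\<^esub> = \<zero>\<^bsub>W\<^esub>"
proof -
  interpret linear_map K V W f by fact
  show "x \<in> carrier V \<Longrightarrow> f x \<in> carrier W" by (rule f_im)
  show "\<lbrakk>x \<in> carrier V; y \<in> carrier V\<rbrakk> \<Longrightarrow> f (x \<oplus>\<^bsub>V\<^esub> y) = f x \<oplus>\<^bsub>W\<^esub> f y" by (rule f_add)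
  show "\<lbrakk>x \<in> carrier V; y \<in> carrier V\<rbrakk> \<Longrightarrow> f (x \<ominus>\<^bsub>V\<^esub> y) = f x \<ominus>\<^bsub>W\<^esub> f y" by (rule f_diff)
  show "f \<zero>\<^bsub>V\<^esub> = \<zero>\<^bsub>W\<^esub>" by (rule f0_is_0)
qed

lemma linear_map_cong:
  assumes "linear_map K V W f" and "\<And>x. x \<in> carrier V \<Longrightarrow> g x = f x"
  shows "linear_map K V W g"
proof -
  interpret f: linear_map K V W f by fact
  show ?thesis
    by (rule linear_mapI) (simp_all add: assms(2) f.V.vectorspace_axioms f.W.vectorspace_axioms)
qed

context vectorspace
begin

lemma linear_map_add:
  assumes "linear_map K V V f" "linear_map K V V g"
  shows "linear_map K V V (\<lambda>x. f x \<oplus>\<^bsub>V\<^esub> g x)"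
proof -
  interpret f: linear_map K V V f by fact
  interpret g: linear_map K V V g by fact
  show ?thesis
    by (rule linear_mapI) (auto simp: smult_simps M.group_simps vectorspace_axioms)
qed

lemma linear_map_diff:
  assumes "linear_map K V V f" "linear_map K V V g"
  shows "linear_map K V V (\<lambda>x. f x \<ominus>\<^bsub>V\<^esub> g x)"
proof -
  interpret f: linear_map K V V f by fact
  interpret g: linear_map K V V g by fact
  show ?thesis
    by (rule linear_mapI) (auto simp: smult_simps M.group_simps vectorspace_axioms)
qed

end

section \<open>Affine structure of a vector space\<close>

text \<open>
  The affine space is kept apart from its vector space, since it may be given first and carry
  further structure; it only has to agree with the canonical one on the carrier.
\<close>

locale vectorised_affine_space = vectorspace K V
  for K :: "('k, 'r) ring_scheme" and V :: "('k, 'a, 'v) module_scheme" (structure) +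
  fixes A :: "('k, 'a, 'm) affine_scheme"
  assumes carrier_eq [simp]: "carrier A = carrier V"
    and tern_eq: "\<lbrakk>a \<in> carrier V; b \<in> carrier V; c \<in> carrier V\<rbrakk> \<Longrightarrow> tern A a b c = (a \<ominus> b) \<oplus> c"
    and act_eq: "\<lbrakk>\<xi> \<in> carrier K; a \<in> carrier V; b \<in> carrier V\<rbrakk> \<Longrightarrow> act A \<xi> a b = a \<oplus> \<xi> \<odot> (b \<ominus> a)"
begin

lemma is_affine_space: "affine_space K A"
proof (intro affine_space.intro abelian_heap.intro affine_space_axioms.intro field_axioms)
qed (auto simp: tern_eq act_eq heap_hom_def group_heap_def smult_simps M.group_simps)

text \<open>
  Sums and multiples are heap and action terms based at the origin, \<open>x + y = \<langle>x,0,y\<rangle>\<close> and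
  \<open>\<xi> x = \<xi> \<triangleright>\<^sub>0 x\<close>, so that an affine map fails to be linear only by its value at \<open>0\<close>.
\<close>

lemma linear_part:
  assumes f: "f \<in> affine_maps K A A"
  shows "linear_map K V V (\<lambda>x. f x \<ominus> f \<zero>)"
proof (rule linear_mapI)
  have closed: "f x \<in> carrier V" if "x \<in> carrier V" for x
    using f that by (auto simp: affine_maps_def heap_hom_def)
  show "f x \<ominus> f \<zero> \<in> carrier V" if "x \<in> carrier V" for x
    using that closed by simp
  show "f (x \<oplus> y) \<ominus> f \<zero> = (f x \<ominus> f \<zero>) \<oplus> (f y \<ominus> f \<zero>)"
    if xy: "x \<in> carrier V" "y \<in> carrier V" for x y
  proof -
    have "f (tern A x \<zero> y) = tern A (f x) (f \<zero>) (f y)"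
      using f xy by (simp add: affine_maps_def heap_hom_def)
    then show ?thesis
      using xy closed by (simp add: tern_eq M.diff_zero M.group_simps)
  qed
  show "f (\<xi> \<odot> x) \<ominus> f \<zero> = \<xi> \<odot> (f x \<ominus> f \<zero>)"
    if x: "\<xi> \<in> carrier K" "x \<in> carrier V" for \<xi> x
  proof -
    have "f (act A \<xi> \<zero> x) = act A \<xi> (f \<zero>) (f x)"
      using f x by (simp add: affine_maps_def)
    then show ?thesis
      using x closed by (simp add: act_eq M.diff_zero smult_simps M.group_simps)
  qed
qed (rule vectorspace_axioms)+

lemma affine_mapI:
  assumes "linear_map K V V g" and c: "c \<in> carrier V"
    and f: "\<And>x. x \<in> carrier V \<Longrightarrow> f x = g x \<oplus> c"
  shows "f \<in> affine_maps K A A"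
proof -
  interpret g: linear_map K V V g by fact
  show ?thesis
    using c by (auto simp: affine_maps_def heap_hom_def tern_eq act_eq f g.f_diff smult_simps M.group_simps)
qed

end

lemma fibre_carrier: "carrier (fibre A u) = carrier A"
  and fibre_tw [simp]: "lie_tw (fibre A u) = aff_tw A"
  and fibre_zero: "\<zero>\<^bsub>fibre A u\<^esub> = u"
  and fibre_add: "a \<oplus>\<^bsub>fibre A u\<^esub> b = tern A a u b"
  and fibre_smult: "\<xi> \<odot>\<^bsub>fibre A u\<^esub> a = act A \<xi> u a"
  and fibre_br: "lie_br (fibre A u) a b =
    tern5 A (aff_br A a b) (aff_br A a u) (aff_br A u u) (aff_br A u b) u"
  by (simp_all add: fibre_def)

section \<open>Affgebras presented by a bilinear bracket\<close>

text \<open>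
  Only the linear structure is fixed here. Skew symmetry, the Hom-Jacobi identity and the
  compatibility condition on \<open>L\<close> are left open, in order to be compared with the identities that
  make \<open>A\<close> a Hom-Lie affgebra.
\<close>

locale affgebra_presentation = vectorspace K L
  for K :: "('k, 'r) ring_scheme" and L :: "('k, 'a, 'l) hom_lie_scheme" (structure) +
  fixes A :: "('k, 'a, 'm) hom_lie_aff_scheme" and \<kappa> lam :: "'a \<Rightarrow> 'a" and r :: 'a
  assumes br_left: "b \<in> carrier L \<Longrightarrow> linear_map K L L (\<lambda>a. lie_br L a b)"
    and br_right: "a \<in> carrier L \<Longrightarrow> linear_map K L L (lie_br L a)"
    and tw: "linear_map K L L (lie_tw L)"
    and kappa: "linear_map K L L \<kappa>"
    and lam: "linear_map K L L lam"
    and r_closed [simp]: "r \<in> carrier L"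
    and model: "same_hom_lie_affgebra K A (affgebra_of K L \<kappa> lam r)"
begin

lemma carrier_model [simp]: "carrier A = carrier L"
  using model by (simp add: same_hom_lie_affgebra_def affgebra_of_def)

lemma aff_tw_eq: "a \<in> carrier L \<Longrightarrow> aff_tw A a = lie_tw L a"
  using model by (simp add: same_hom_lie_affgebra_def affgebra_of_def)

lemmas linear_simps [simp] =
  linear_mapD[OF br_left] linear_mapD[OF br_right] linear_mapD[OF tw] linear_mapD[OF kappa]
  linear_mapD[OF lam]

lemma aff_br_eq:
  "\<lbrakk>a \<in> carrier L; b \<in> carrier L\<rbrakk> \<Longrightarrow>
    aff_br A a b = ((lie_br L a b \<oplus> \<kappa> a) \<oplus> (lam b \<ominus> lam a)) \<oplus> r"
  using model by (simp add: same_hom_lie_affgebra_def affgebra_of_def)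

sublocale vectorised_affine_space K L A
proof
  show "tern A a b c = (a \<ominus> b) \<oplus> c"
    if "a \<in> carrier L" "b \<in> carrier L" "c \<in> carrier L" for a b c
    using model that by (simp add: same_hom_lie_affgebra_def affgebra_of_def)
  show "act A \<xi> a b = a \<oplus> \<xi> \<odot> (b \<ominus> a)"
    if "\<xi> \<in> carrier K" "a \<in> carrier L" "b \<in> carrier L" for \<xi> a b
    using model that
    by (simp add: same_hom_lie_affgebra_def affgebra_of_def smult_simps M.group_simps)
qed simp

lemma br_affine_left:
  assumes "b \<in> carrier L"
  shows "(\<lambda>a. aff_br A a b) \<in> affine_maps K A A"
proof (rule affine_mapI)
  show "linear_map K L L (\<lambda>a. (lie_br L a b \<oplus> \<kappa> a) \<ominus> lam a)"
    using assms by (intro linear_map_add linear_map_diff br_left kappa lam)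
  show "lam b \<oplus> r \<in> carrier L" using assms by simp
qed (use assms in \<open>simp add: aff_br_eq M.group_simps\<close>)

lemma br_affine_right:
  assumes "a \<in> carrier L"
  shows "aff_br A a \<in> affine_maps K A A"
proof (rule affine_mapI)
  show "linear_map K L L (\<lambda>b. lie_br L a b \<oplus> lam b)"
    using assms by (intro linear_map_add br_right lam)
  show "(\<kappa> a \<ominus> lam a) \<oplus> r \<in> carrier L" using assms by simp
qed (use assms in \<open>simp add: aff_br_eq M.group_simps\<close>)

lemma tw_affine: "aff_tw A \<in> affine_maps K A A"
proof (rule affine_mapI)
  show "linear_map K L L (lie_tw L)" by (rule tw)
  show "\<zero> \<in> carrier L" by simp
qed (simp add: aff_tw_eq)

lemma alternating_imp_skew:
  assumes "\<forall>a\<in>carrier L. lie_br L a a = \<zero>" "a \<in> carrier L" "b \<in> carrier L"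
  shows "lie_br L a b = \<ominus> lie_br L b a"
proof -
  have "\<zero> = lie_br L (a \<oplus> b) (a \<oplus> b)"
    using assms by (metis M.a_closed)
  also have "\<dots> = (lie_br L a a \<oplus> lie_br L b b) \<oplus> (lie_br L a b \<oplus> lie_br L b a)"
    using assms(2,3) by (simp add: M.a_ac)
  also have "\<dots> = lie_br L a b \<oplus> lie_br L b a"
    using assms by simp
  finally show ?thesis
    using assms by (simp add: M.minus_equality)
qed

lemma skew_imp_alternating:
  assumes char: "\<one>\<^bsub>K\<^esub> \<oplus>\<^bsub>K\<^esub> \<one>\<^bsub>K\<^esub> \<noteq> \<zero>\<^bsub>K\<^esub>" and a: "a \<in> carrier L"
    and skew: "lie_br L a a = \<ominus> lie_br L a a"
  shows "lie_br L a a = \<zero>"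
proof -
  let ?x = "lie_br L a a" and ?two = "\<one>\<^bsub>K\<^esub> \<oplus>\<^bsub>K\<^esub> \<one>\<^bsub>K\<^esub>"
  have x: "?x \<in> carrier L" using a by simp
  have two: "?two \<in> Units K" using char by (simp add: field_Units)
  have "?two \<odot> ?x = ?x \<oplus> ?x" using x by (simp add: smult_l_distr)
  also have "\<dots> = \<zero>" using skew x by (metis M.l_neg)
  finally have "inv\<^bsub>K\<^esub> ?two \<odot> (?two \<odot> ?x) = \<zero>" using two by simp
  moreover have "inv\<^bsub>K\<^esub> ?two \<odot> (?two \<odot> ?x) = (inv\<^bsub>K\<^esub> ?two \<otimes>\<^bsub>K\<^esub> ?two) \<odot> ?x"
    using x two by (intro smult_assoc1[symmetric]) auto
  ultimately show ?thesis using x two by simp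
qed

lemma aff_antisymmetry_iff:
  assumes "a \<in> carrier L" "b \<in> carrier L"
  shows "tern A (aff_br A a b) (aff_br A a a) (aff_br A b a) = aff_br A b b \<longleftrightarrow>
    lie_br L a b \<oplus> lie_br L b a = lie_br L a a \<oplus> lie_br L b b"
proof -
  have aux: "x = y \<longleftrightarrow> p = q"
    if "x \<ominus> y = p \<ominus> q" "x \<in> carrier L" "y \<in> carrier L" "p \<in> carrier L" "q \<in> carrier L"
    for x y p q
    using that by (metis M.minus_other_side)
  show ?thesis
    by (rule aux) (use assms in \<open>simp_all add: aff_br_eq tern_eq M.group_simps\<close>)
qed

lemma antisymmetry_iff_alternating:
  "(\<forall>a\<in>carrier L. \<forall>b\<in>carrier L.
      tern A (aff_br A a b) (aff_br A a a) (aff_br A b a) = aff_br A b b)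
    \<longleftrightarrow> (\<forall>a\<in>carrier L. lie_br L a a = \<zero>)"
proof
  assume L: "\<forall>a\<in>carrier L. \<forall>b\<in>carrier L.
      tern A (aff_br A a b) (aff_br A a a) (aff_br A b a) = aff_br A b b"
  show "\<forall>a\<in>carrier L. lie_br L a a = \<zero>"
  proof
    fix a assume a: "a \<in> carrier L"
    have "lie_br L a \<zero> \<oplus> lie_br L \<zero> a = lie_br L a a \<oplus> lie_br L \<zero> \<zero>"
      using L a by (intro aff_antisymmetry_iff[THEN iffD1]) simp_all
    then show "lie_br L a a = \<zero>" using a by simp
  qed
next
  assume R: "\<forall>a\<in>carrier L. lie_br L a a = \<zero>"
  show "\<forall>a\<in>carrier L. \<forall>b\<in>carrier L.
      tern A (aff_br A a b) (aff_br A a a) (aff_br A b a) = aff_br A b b"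
  proof (intro ballI)
    fix a b assume ab: "a \<in> carrier L" "b \<in> carrier L"
    have "lie_br L a b \<oplus> lie_br L b a = \<zero>"
      using alternating_imp_skew[OF R ab] ab by (simp add: M.l_neg)
    then show "tern A (aff_br A a b) (aff_br A a a) (aff_br A b a) = aff_br A b b"
      using R ab by (simp add: aff_antisymmetry_iff)
  qed
qed

definition jacobiator :: "'a \<Rightarrow> 'a \<Rightarrow> 'a \<Rightarrow> 'a"
  where "jacobiator a b c = lie_br L (lie_tw L a) (lie_br L b c)
    \<oplus> lie_br L (lie_tw L b) (lie_br L c a) \<oplus> lie_br L (lie_tw L c) (lie_br L a b)"

text \<open>The difference of the two sides of the compatibility condition.\<close>

definition defect :: "'a \<Rightarrow> 'a \<Rightarrow> 'a"
  where "defect a b = lam (lie_br L a b) \<ominus>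
    ((lie_br L (lam a) (lie_tw L b) \<ominus> lie_br L (lie_tw L a) (\<kappa> b)) \<oplus> lie_br L (lie_tw L a) (lam b))"

text \<open>
  The affine Hom-Jacobi identity compares each \<open>{\<alpha> a, {b,c}}\<close> with \<open>{\<alpha> a, {a,a}}\<close>. The constant
  and the part depending on \<open>\<alpha> a\<close> alone cancel in the difference, which is the increment below.
  The six-term identity then says that the cyclic sum of the increments is zero.
\<close>

definition increment :: "'a \<Rightarrow> 'a \<Rightarrow> 'a \<Rightarrow> 'a"
  where "increment a b c =
    lie_br L (lie_tw L a) (aff_br A b c \<ominus> aff_br A a a) \<oplus> lam (aff_br A b c \<ominus> aff_br A a a)"

lemma closed [simp]:
  "\<lbrakk>a \<in> carrier L; b \<in> carrier L\<rbrakk> \<Longrightarrow> aff_br A a b \<in> carrier L"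
  "\<lbrakk>a \<in> carrier L; b \<in> carrier L; c \<in> carrier L\<rbrakk> \<Longrightarrow> jacobiator a b c \<in> carrier L"
  "\<lbrakk>a \<in> carrier L; b \<in> carrier L\<rbrakk> \<Longrightarrow> defect a b \<in> carrier L"
  "\<lbrakk>a \<in> carrier L; b \<in> carrier L; c \<in> carrier L\<rbrakk> \<Longrightarrow> increment a b c \<in> carrier L"
  by (simp_all add: aff_br_eq jacobiator_def defect_def increment_def)

lemma aff_br_increment:
  assumes "a \<in> carrier L" "b \<in> carrier L" "c \<in> carrier L"
  shows "aff_br A (lie_tw L a) (aff_br A b c)
    = aff_br A (lie_tw L a) (aff_br A a a) \<oplus> increment a b c"
proof -
  have step: "aff_br A x y = aff_br A x z \<oplus> (lie_br L x (y \<ominus> z) \<oplus> lam (y \<ominus> z))"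
    if "x \<in> carrier L" "y \<in> carrier L" "z \<in> carrier L" for x y z
    using that by (simp add: aff_br_eq M.group_simps)
  show ?thesis
    unfolding increment_def by (rule step) (use assms in simp_all)
qed

lemma aff_jacobi_iff_increments:
  assumes "a \<in> carrier L" "b \<in> carrier L" "c \<in> carrier L"
  shows "tern5 A (aff_br A (lie_tw L a) (aff_br A b c)) (aff_br A (lie_tw L a) (aff_br A a a))
                (aff_br A (lie_tw L b) (aff_br A c a)) (aff_br A (lie_tw L b) (aff_br A b b))
                (aff_br A (lie_tw L c) (aff_br A a b))
        = aff_br A (lie_tw L c) (aff_br A c c)
    \<longleftrightarrow> increment a b c \<oplus> increment b c a \<oplus> increment c a b = \<zero>"
proof -
  have aux: "((((x \<oplus> p) \<ominus> x) \<oplus> (y \<oplus> q)) \<ominus> y) \<oplus> (z \<oplus> s) = z \<oplus> (p \<oplus> q \<oplus> s)"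
    if "x \<in> carrier L" "y \<in> carrier L" "z \<in> carrier L"
      "p \<in> carrier L" "q \<in> carrier L" "s \<in> carrier L" for x y z p q s
    using that by (simp add: M.group_simps)
  show ?thesis
    using assms
    by (simp add: aff_br_increment[of a b c] aff_br_increment[of b c a] aff_br_increment[of c a b]
        tern_eq aux)
qed

text \<open>
  In the cyclic sum the terms \<open>\<lambda> \<kappa>\<close> and \<open>\<lambda> \<lambda>\<close> telescope, and the brackets \<open>[\<alpha> a, [b,c]]\<close> form the
  jacobiator. The remaining terms \<open>\<lambda> [a,b]\<close>, \<open>[\<alpha> a, \<kappa> b]\<close>, \<open>[\<alpha> a, \<lambda> b]\<close> and \<open>[\<alpha> a, \<lambda> c]\<close> are those
  of the compatibility condition once \<open>[\<alpha> a, \<lambda> c]\<close> is turned into \<open>- [\<lambda> c, \<alpha> a]\<close>. They leave the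
  diagonal terms \<open>[\<alpha> a, \<kappa> a]\<close>, which are defects as well.
\<close>

lemma increment_sum:
  assumes alt: "\<forall>a\<in>carrier L. lie_br L a a = \<zero>"
    and abc: "a \<in> carrier L" "b \<in> carrier L" "c \<in> carrier L"
  shows "increment a b c \<oplus> increment b c a \<oplus> increment c a b =
    (jacobiator a b c \<oplus> (defect a b \<oplus> defect b c \<oplus> defect c a))
      \<ominus> (defect a a \<oplus> defect b b \<oplus> defect c c)"
proof -
  have skew: "lie_br L (lam x) (lie_tw L y) = \<zero> \<ominus> lie_br L (lie_tw L y) (lam x)"
    if "x \<in> carrier L" "y \<in> carrier L" for x y
    using alternating_imp_skew[OF alt, of "lam x" "lie_tw L y"] that
    by (simp add: M.inv_eq_zero_diff)
  have diff: "aff_br A y z \<ominus> aff_br A x x = (lie_br L y z \<oplus> (\<kappa> y \<ominus> \<kappa> x)) \<oplus> (lam z \<ominus> lam y)"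
    if "x \<in> carrier L" "y \<in> carrier L" "z \<in> carrier L" for x y z
    using that alt by (simp add: aff_br_eq M.group_simps)
  have diag: "defect x x = lie_br L (lie_tw L x) (\<kappa> x)" if "x \<in> carrier L" for x
    using that alt by (simp add: defect_def skew M.group_simps)
  show ?thesis
    using abc
    by (simp add: alt diag increment_def diff jacobiator_def defect_def skew M.group_simps)
qed

lemma aff_jacobi_iff:
  assumes alt: "\<forall>a\<in>carrier L. lie_br L a a = \<zero>"
  shows "(\<forall>a\<in>carrier L. \<forall>b\<in>carrier L. \<forall>c\<in>carrier L.
      tern5 A (aff_br A (lie_tw L a) (aff_br A b c)) (aff_br A (lie_tw L a) (aff_br A a a))
              (aff_br A (lie_tw L b) (aff_br A c a)) (aff_br A (lie_tw L b) (aff_br A b b))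
              (aff_br A (lie_tw L c) (aff_br A a b))
      = aff_br A (lie_tw L c) (aff_br A c c))
    \<longleftrightarrow> (\<forall>a\<in>carrier L. \<forall>b\<in>carrier L. \<forall>c\<in>carrier L. jacobiator a b c = \<zero>)
      \<and> (\<forall>a\<in>carrier L. \<forall>b\<in>carrier L. defect a b = \<zero>)"
    (is "?aff \<longleftrightarrow> ?lie")
proof
  assume ?aff
  then have sum: "(jacobiator a b c \<oplus> (defect a b \<oplus> defect b c \<oplus> defect c a))
      \<ominus> (defect a a \<oplus> defect b b \<oplus> defect c c) = \<zero>"
    if "a \<in> carrier L" "b \<in> carrier L" "c \<in> carrier L" for a b c
    using that by (simp add: aff_jacobi_iff_increments increment_sum[OF alt])
  have zero: "jacobiator a b \<zero> = \<zero>" "defect a \<zero> = \<zero>" "defect \<zero> a = \<zero>"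
    if "a \<in> carrier L" "b \<in> carrier L" for a b
    using that by (simp_all add: jacobiator_def defect_def M.diff_zero)
  have diag: "defect a a = \<zero>" if "a \<in> carrier L" for a
    using sum[of a \<zero> \<zero>] that by (simp add: zero M.group_simps)
  have defect: "defect a b = \<zero>" if "a \<in> carrier L" "b \<in> carrier L" for a b
    using sum[of a b \<zero>] that by (simp add: zero diag M.diff_zero)
  show ?lie
    using sum by (simp add: defect M.diff_zero)
next
  assume ?lie
  then show ?aff
    by (simp add: aff_jacobi_iff_increments increment_sum[OF alt] M.diff_zero)
qed

lemma lie_compatible_iff:
  "lie_compatible L \<kappa> lam \<longleftrightarrow> (\<forall>a\<in>carrier L. \<forall>b\<in>carrier L. defect a b = \<zero>)"
  by (simp add: lie_compatible_def defect_def)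

text \<open>
  The characteristic enters where skew symmetry of the Lie bracket has to yield \<open>[a,a] = 0\<close>.
\<close>

theorem hom_lie_affgebra_iff:
  assumes "\<one>\<^bsub>K\<^esub> \<oplus>\<^bsub>K\<^esub> \<one>\<^bsub>K\<^esub> \<noteq> \<zero>\<^bsub>K\<^esub>"
  shows "hom_lie_affgebra K A \<longleftrightarrow> hom_lie_algebra K L \<and> lie_compatible L \<kappa> lam"
proof
  assume "hom_lie_affgebra K A"
  then interpret A: hom_lie_affgebra K A .
  have alt: "\<forall>a\<in>carrier L. lie_br L a a = \<zero>"
    using A.aff_antisymmetry by (simp flip: antisymmetry_iff_alternating)
  have "(\<forall>a\<in>carrier L. \<forall>b\<in>carrier L. \<forall>c\<in>carrier L. jacobiator a b c = \<zero>)
      \<and> (\<forall>a\<in>carrier L. \<forall>b\<in>carrier L. defect a b = \<zero>)"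
    unfolding aff_jacobi_iff[OF alt, symmetric] using A.aff_hom_jacobi by (simp add: aff_tw_eq)
  then have J: "\<And>a b c. \<lbrakk>a \<in> carrier L; b \<in> carrier L; c \<in> carrier L\<rbrakk> \<Longrightarrow> jacobiator a b c = \<zero>"
    and D: "lie_compatible L \<kappa> lam"
    by (auto simp: lie_compatible_iff)
  have "hom_lie_algebra K L"
  proof (intro hom_lie_algebra.intro vectorspace_axioms hom_lie_algebra_axioms.intro
      br_left br_right tw)
    fix a b assume "a \<in> carrier L" "b \<in> carrier L"
    then show "lie_br L a b = \<ominus> lie_br L b a" by (rule alternating_imp_skew[OF alt])
  qed (use J in \<open>simp_all add: jacobiator_def\<close>)
  then show "hom_lie_algebra K L \<and> lie_compatible L \<kappa> lam"
    using D by blast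
next
  assume L: "hom_lie_algebra K L \<and> lie_compatible L \<kappa> lam"
  then interpret H: hom_lie_algebra K L by simp
  have alt: "\<forall>a\<in>carrier L. lie_br L a a = \<zero>"
    using skew_imp_alternating[OF assms] H.br_skew by blast
  have "(\<forall>a\<in>carrier L. \<forall>b\<in>carrier L. \<forall>c\<in>carrier L. jacobiator a b c = \<zero>)
      \<and> (\<forall>a\<in>carrier L. \<forall>b\<in>carrier L. defect a b = \<zero>)"
    using L H.hom_jacobi by (simp add: lie_compatible_iff jacobiator_def)
  note jacobi = aff_jacobi_iff[OF alt, THEN iffD2, OF this]
  show "hom_lie_affgebra K A"
  proof (intro hom_lie_affgebra.intro is_affine_space hom_lie_affgebra_axioms.intro)
    fix a b assume "a \<in> carrier A" "b \<in> carrier A"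
    then show "tern A (aff_br A a b) (aff_br A a a) (aff_br A b a) = aff_br A b b"
      using alt by (simp flip: antisymmetry_iff_alternating)
  next
    fix a b c assume "a \<in> carrier A" "b \<in> carrier A" "c \<in> carrier A"
    then show "tern5 A (aff_br A (aff_tw A a) (aff_br A b c)) (aff_br A (aff_tw A a) (aff_br A a a))
        (aff_br A (aff_tw A b) (aff_br A c a)) (aff_br A (aff_tw A b) (aff_br A b b))
        (aff_br A (aff_tw A c) (aff_br A a b)) = aff_br A (aff_tw A c) (aff_br A c c)"
      using jacobi[rule_format, of a b c] by (simp add: aff_tw_eq)
  qed (simp_all add: br_affine_left br_affine_right tw_affine)
qed

text \<open>
  Each condition on \<open>L\<close> is isolated by zero arguments: \<open>(0,0)\<close> shows that \<open>r\<close> is fixed,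
  \<open>(0,b)\<close> then gives the commutation of \<open>lam\<close> and \<open>(a,0)\<close> that of \<open>\<kappa>\<close>, and what is left of
  the general case concerns the Lie bracket alone.
\<close>

theorem multiplicative_iff:
  "multiplicative_hom_lie_affgebra K A \<longleftrightarrow> hom_lie_affgebra K A \<and>
    tw_multiplicative L \<and> lie_tw L r = r \<and> commutes_with_twist L \<kappa> \<and> commutes_with_twist L lam"
proof -
  have "(\<forall>a\<in>carrier L. \<forall>b\<in>carrier L. lie_tw L (aff_br A a b) = aff_br A (lie_tw L a) (lie_tw L b))
    \<longleftrightarrow> tw_multiplicative L \<and> lie_tw L r = r \<and> commutes_with_twist L \<kappa> \<and> commutes_with_twist L lam"
    (is "?aff \<longleftrightarrow> ?lie")
  proof
    assume aff: ?aff
    have r: "lie_tw L r = r"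
      using aff[rule_format, of \<zero> \<zero>] by (simp add: aff_br_eq M.diff_zero)
    have lam: "lie_tw L (lam b) = lam (lie_tw L b)" if "b \<in> carrier L" for b
      using aff[rule_format, of \<zero> b] that by (simp add: aff_br_eq M.diff_zero r)
    have kappa: "lie_tw L (\<kappa> a) = \<kappa> (lie_tw L a)" if "a \<in> carrier L" for a
      using aff[rule_format, of a \<zero>] that by (simp add: aff_br_eq lam r)
    have "lie_tw L (lie_br L a b) = lie_br L (lie_tw L a) (lie_tw L b)"
      if "a \<in> carrier L" "b \<in> carrier L" for a b
      using aff[rule_format, of a b] that by (simp add: aff_br_eq lam kappa r)
    then show ?lie
      by (simp add: tw_multiplicative_def commutes_with_twist_def r lam kappa)
  next
    assume ?lie
    then show ?aff
      by (simp add: tw_multiplicative_def commutes_with_twist_def aff_br_eq)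
  qed
  then show ?thesis
    by (auto simp: multiplicative_hom_lie_affgebra_def multiplicative_hom_lie_affgebra_axioms_def
        aff_tw_eq)
qed

text \<open>
  Translation by \<open>u\<close> turns the fibre at \<open>u\<close> into \<open>L\<close>. It respects the twisting maps because
  \<open>u\<close> is a fixed point.
\<close>

lemma fibre_iso:
  assumes "hom_lie_algebra K L" "hom_lie_algebra K (fibre A u)"
    and u: "u \<in> carrier L" and fixed: "aff_tw A u = u"
  shows "hom_lie_iso K (fibre A u) L"
proof -
  interpret F: hom_lie_algebra K "fibre A u" by fact
  let ?f = "\<lambda>a. a \<ominus> u"
  have "linear_map K (fibre A u) L ?f"
  proof (rule linear_mapI[OF F.vectorspace_axioms vectorspace_axioms])
    fix \<xi> x assume "\<xi> \<in> carrier K" "x \<in> carrier (fibre A u)"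
    then show "(\<xi> \<odot>\<^bsub>fibre A u\<^esub> x) \<ominus> u = \<xi> \<odot> (x \<ominus> u)"
      using u by (simp add: fibre_carrier fibre_smult act_eq M.group_simps)
  qed (use u in \<open>simp_all add: fibre_carrier fibre_add tern_eq M.group_simps\<close>)
  moreover have "bij_betw ?f (carrier (fibre A u)) (carrier L)"
    by (rule bij_betw_byWitness[where f' = "\<lambda>x. x \<oplus> u"]) (use u in \<open>auto simp: fibre_carrier M.group_simps\<close>)
  moreover have "?f (lie_br (fibre A u) a b) = lie_br L (?f a) (?f b)"
    if "a \<in> carrier (fibre A u)" "b \<in> carrier (fibre A u)" for a b
    using u that by (simp add: fibre_carrier fibre_br tern_eq aff_br_eq M.group_simps)
  moreover have "?f (lie_tw (fibre A u) a) = lie_tw L (?f a)" if "a \<in> carrier (fibre A u)" for a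
    using u that fixed by (simp add: fibre_carrier aff_tw_eq)
  ultimately show ?thesis
    using assms(1,2) unfolding hom_lie_iso_def by blast
qed

end

section \<open>The fibre as a presentation\<close>

lemma (in affine_space) act_base: "\<lbrakk>\<xi> \<in> carrier K; a \<in> carrier A\<rbrakk> \<Longrightarrow> act A \<xi> a a = a"
  using act_base_change[of \<xi> a a a] act_hom[of \<xi> a] tern_left_cancel[of "act A \<xi> a a" a]
  by (auto simp: heap_hom_def)

lemma fibre_vectorspace:
  fixes A :: "('k, 'a, 'm) hom_lie_aff_scheme"
  assumes "affine_space K A" and u: "u \<in> carrier A"
  shows "vectorspace K (fibre A u)"
proof -
  interpret A: affine_space K A by fact
  have group: "abelian_group (fibre A u)"
  proof (rule abelian_groupI; simp add: fibre_carrier fibre_add fibre_zero)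
    fix a b c assume abc: "a \<in> carrier A" "b \<in> carrier A" "c \<in> carrier A"
    show "tern A (tern A a u b) u c = tern A a u (tern A b u c)"
      using abc u by (simp add: A.tern_assoc)
  next
    fix a assume a: "a \<in> carrier A"
    have "tern A (tern A u a u) u a = u"
      using a u by (simp add: A.tern_assoc A.tern_left_cancel A.tern_right_cancel)
    then show "\<exists>y\<in>carrier A. tern A y u a = u"
      using a u by (meson A.tern_closed)
  next
    fix a b assume "a \<in> carrier A" "b \<in> carrier A"
    then show "tern A a u b = tern A b u a" using u by (intro A.tern_comm)
  qed (use u in \<open>simp_all add: A.tern_closed A.tern_left_cancel\<close>)
  have "module K (fibre A u)"
  proof (rule moduleI[OF _ group]; (simp add: fibre_carrier fibre_add fibre_smult)?)
    fix \<xi> \<zeta> a b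
    assume \<xi>: "\<xi> \<in> carrier K" and \<zeta>: "\<zeta> \<in> carrier K"
      and a: "a \<in> carrier A" and b: "b \<in> carrier A"
    show "act A \<xi> u a \<in> carrier A"
      using A.act_hom[OF \<xi> u] a by (auto simp: heap_hom_def)
    (* Addition of scalars is the heap operation \<xi> - 0 + \<zeta>, and 0 acts with value u. *)
    have "act A ((\<xi> \<ominus>\<^bsub>K\<^esub> \<zero>\<^bsub>K\<^esub>) \<oplus>\<^bsub>K\<^esub> \<zeta>) u a = tern A (act A \<xi> u a) (act A \<zero>\<^bsub>K\<^esub> u a) (act A \<zeta> u a)"
      using A.act_hom_scalar[OF u a] \<xi> \<zeta> by (simp add: heap_hom_def group_heap_def)
    then show "act A (\<xi> \<oplus>\<^bsub>K\<^esub> \<zeta>) u a = tern A (act A \<xi> u a) u (act A \<zeta> u a)"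
      using u a \<xi> by (simp add: A.act_zero A.diff_zero)
    show "act A \<xi> u (tern A a u b) = tern A (act A \<xi> u a) u (act A \<xi> u b)"
      using A.act_hom[OF \<xi> u] u a b by (simp add: heap_hom_def A.act_base[OF \<xi> u])
  qed (use u in \<open>simp_all add: A.act_mult A.act_one A.cring_axioms\<close>)
  then show ?thesis
    by (simp add: vectorspace_def A.field_axioms)
qed

text \<open>
  In the fibre \<open>- b = \<langle>u,b,u\<rangle>\<close>, so differences are heap terms; the action based at an arbitrary
  point is moved to \<open>u\<close> by the base change axiom.
\<close>

lemma fibre_vectorises:
  fixes A :: "('k, 'a, 'm) hom_lie_aff_scheme"
  assumes "affine_space K A" and u: "u \<in> carrier A"
  shows "vectorised_affine_space K (fibre A u) A"
proof -
  interpret A: affine_space K A by fact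
  interpret V: vectorspace K "fibre A u" using assms by (rule fibre_vectorspace)
  have tern: "tern A a b c = (a \<ominus>\<^bsub>fibre A u\<^esub> b) \<oplus>\<^bsub>fibre A u\<^esub> c"
    if abc: "a \<in> carrier (fibre A u)" "b \<in> carrier (fibre A u)" "c \<in> carrier (fibre A u)" for a b c
  proof -
    note abc' = abc[unfolded fibre_carrier]
    have "\<ominus>\<^bsub>fibre A u\<^esub> b = tern A u b u"
      using abc' u by (intro V.M.minus_equality)
        (simp_all add: fibre_carrier fibre_add fibre_zero A.tern_closed A.tern_assoc
          A.tern_left_cancel A.tern_right_cancel)
    then have "a \<ominus>\<^bsub>fibre A u\<^esub> b = tern A a u (tern A u b u)"
      by (simp add: V.M.minus_eq fibre_add)
    also have "\<dots> = tern A a b u"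
      using abc' u by (metis A.tern_assoc A.tern_right_cancel)
    finally show ?thesis
      using abc' u by (simp add: fibre_add A.tern_assoc A.tern_left_cancel)
  qed
  show ?thesis
  proof
    fix \<xi> a b
    assume \<xi>: "\<xi> \<in> carrier K" and ab: "a \<in> carrier (fibre A u)" "b \<in> carrier (fibre A u)"
    have "act A \<xi> a b = tern A (\<xi> \<odot>\<^bsub>fibre A u\<^esub> b) (\<xi> \<odot>\<^bsub>fibre A u\<^esub> a) a"
      using A.act_base_change[OF \<xi> _ _ u] ab by (simp add: fibre_smult fibre_carrier)
    also have "\<dots> = (\<xi> \<odot>\<^bsub>fibre A u\<^esub> b \<ominus>\<^bsub>fibre A u\<^esub> \<xi> \<odot>\<^bsub>fibre A u\<^esub> a) \<oplus>\<^bsub>fibre A u\<^esub> a"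
      using \<xi> ab by (intro tern V.smult_closed)
    also have "\<dots> = a \<oplus>\<^bsub>fibre A u\<^esub> \<xi> \<odot>\<^bsub>fibre A u\<^esub> (b \<ominus>\<^bsub>fibre A u\<^esub> a)"
      using \<xi> ab by (simp add: V.smult_diff_right V.M.group_simps)
    finally show "act A \<xi> a b = a \<oplus>\<^bsub>fibre A u\<^esub> \<xi> \<odot>\<^bsub>fibre A u\<^esub> (b \<ominus>\<^bsub>fibre A u\<^esub> a)" .
  qed (simp_all add: tern fibre_carrier[of A u, symmetric])
qed

locale pointed_affgebra = hom_lie_affgebra K A
  for K :: "('k, 'r) ring_scheme" and A :: "('k, 'a, 'm) hom_lie_aff_scheme" +
  fixes u :: 'a
  assumes point: "u \<in> carrier A" and fixed: "aff_tw A u = u"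
begin

abbreviation "T \<equiv> fibre A u"

sublocale V: vectorised_affine_space K "fibre A u" A
  using affine_space_axioms point by (rule fibre_vectorises)

lemma point_closed [simp]: "u \<in> carrier T"
  using point by simp

lemma point_zero: "\<zero>\<^bsub>T\<^esub> = u"
  by (rule fibre_zero)

lemma aff_br_closed [simp]:
  "\<lbrakk>a \<in> carrier T; b \<in> carrier T\<rbrakk> \<Longrightarrow> aff_br A a b \<in> carrier T"
  using br_affine_right[of a] by (auto simp: affine_maps_def heap_hom_def)

text \<open>
  For fixed \<open>b\<close> this is the linear part of \<open>{-,b}\<close> minus that of \<open>{-,u}\<close>, and exchanging the two
  inner brackets gives the same in the second argument. Bilinearity of the fibre bracket follows.
\<close>

lemma fibre_br_eq:
  assumes "a \<in> carrier T" "b \<in> carrier T"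
  shows "lie_br T a b = (aff_br A a b \<ominus>\<^bsub>T\<^esub> aff_br A u b) \<ominus>\<^bsub>T\<^esub> (aff_br A a u \<ominus>\<^bsub>T\<^esub> aff_br A u u)"
proof -
  have "lie_br T a b = ((((aff_br A a b \<ominus>\<^bsub>T\<^esub> aff_br A a u) \<oplus>\<^bsub>T\<^esub> aff_br A u u) \<ominus>\<^bsub>T\<^esub> aff_br A u b)
      \<oplus>\<^bsub>T\<^esub> \<zero>\<^bsub>T\<^esub>)"
    using assms point by (simp add: fibre_br point_zero V.tern_eq del: V.M.r_zero)
  also have "\<dots> = (aff_br A a b \<ominus>\<^bsub>T\<^esub> aff_br A u b) \<ominus>\<^bsub>T\<^esub> (aff_br A a u \<ominus>\<^bsub>T\<^esub> aff_br A u u)"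
    using assms point by (simp add: V.M.group_simps)
  finally show ?thesis .
qed

lemma linear_left:
  assumes "b \<in> carrier T"
  shows "linear_map K T T (\<lambda>a. aff_br A a b \<ominus>\<^bsub>T\<^esub> aff_br A u b)"
  using V.linear_part[OF br_affine_left] assms by (simp add: point_zero)

lemma linear_right:
  assumes "a \<in> carrier T"
  shows "linear_map K T T (\<lambda>b. aff_br A a b \<ominus>\<^bsub>T\<^esub> aff_br A a u)"
  using V.linear_part[OF br_affine_right] assms by (simp add: point_zero)

lemma fibre_br_linear_left:
  assumes "b \<in> carrier T"
  shows "linear_map K T T (\<lambda>a. lie_br T a b)"
  by (rule linear_map_cong,
      rule V.linear_map_diff[OF linear_left[OF assms] linear_left[OF point_closed]])
    (use assms point in \<open>simp_all add: fibre_br_eq\<close>)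

lemma fibre_br_linear_right:
  assumes "a \<in> carrier T"
  shows "linear_map K T T (lie_br T a)"
  by (rule linear_map_cong,
      rule V.linear_map_diff[OF linear_right[OF assms] linear_right[OF point_closed]])
    (use assms point in \<open>simp_all add: fibre_br_eq V.M.group_simps\<close>)

lemma fibre_tw_linear: "linear_map K T T (lie_tw T)"
proof (rule linear_map_cong[OF V.linear_part[OF tw_affine]])
  fix x assume "x \<in> carrier T"
  then have "aff_tw A x \<in> carrier T"
    using tw_affine by (auto simp: affine_maps_def heap_hom_def)
  then show "lie_tw T x = aff_tw A x \<ominus>\<^bsub>T\<^esub> aff_tw A \<zero>\<^bsub>T\<^esub>"
    using V.M.diff_zero[of "aff_tw A x"] by (simp add: point_zero fixed)
qed

lemma presentation_iff:
  "affgebra_presentation K T A \<kappa> lam r \<longleftrightarrow>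
    linear_map K T T \<kappa> \<and> linear_map K T T lam \<and> r \<in> carrier T \<and>
    same_hom_lie_affgebra K A (affgebra_of K T \<kappa> lam r)"
  unfolding affgebra_presentation_def affgebra_presentation_axioms_def
  using fibre_br_linear_left fibre_br_linear_right fibre_tw_linear V.vectorspace_axioms
  by blast

lemma fibre_presentation: "\<exists>\<kappa> lam r. affgebra_presentation K T A \<kappa> lam r"
proof -
  (* The part of the bracket that is linear in the second argument alone is lam; the part linear
     in the first argument alone has to be \<kappa> - lam, because lam is applied to b - a. *)
  define lam where "lam = (\<lambda>b. aff_br A u b \<ominus>\<^bsub>T\<^esub> aff_br A u u)"
  define r where "r = aff_br A u u"
  define \<kappa> where "\<kappa> = (\<lambda>a. (aff_br A a u \<ominus>\<^bsub>T\<^esub> aff_br A u u) \<oplus>\<^bsub>T\<^esub> lam a)"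
  have lam: "linear_map K T T lam"
    unfolding lam_def by (rule linear_right[OF point_closed])
  have \<kappa>: "linear_map K T T \<kappa>"
    unfolding \<kappa>_def by (rule V.linear_map_add[OF linear_left[OF point_closed] lam])
  have "aff_br A a b = ((lie_br T a b \<oplus>\<^bsub>T\<^esub> \<kappa> a) \<oplus>\<^bsub>T\<^esub> lam (b \<ominus>\<^bsub>T\<^esub> a)) \<oplus>\<^bsub>T\<^esub> r"
    if "a \<in> carrier T" "b \<in> carrier T" for a b
  proof -
    have "lam (b \<ominus>\<^bsub>T\<^esub> a) = lam b \<ominus>\<^bsub>T\<^esub> lam a"
      using that by (intro linear_mapD(3)[OF lam]) simp_all
    then show ?thesis
      using that point by (simp add: fibre_br_eq \<kappa>_def lam_def r_def V.M.group_simps)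
  qed
  moreover have "act A \<xi> a b = \<xi> \<odot>\<^bsub>T\<^esub> b \<oplus>\<^bsub>T\<^esub> (\<one>\<^bsub>K\<^esub> \<ominus>\<^bsub>K\<^esub> \<xi>) \<odot>\<^bsub>T\<^esub> a"
    if "\<xi> \<in> carrier K" "a \<in> carrier T" "b \<in> carrier T" for \<xi> a b
    using that by (simp add: V.act_eq V.smult_simps V.M.group_simps)
  ultimately have "same_hom_lie_affgebra K A (affgebra_of K T \<kappa> lam r)"
    by (simp add: same_hom_lie_affgebra_def affgebra_of_def V.tern_eq)
  then have "affgebra_presentation K T A \<kappa> lam r"
    using lam \<kappa> presentation_iff aff_br_closed[OF point_closed point_closed, folded r_def] by blast
  then show ?thesis by blast
qed

end

section \<open>The correspondence\<close>

theorem theorem5p4: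
  fixes K :: "('k, 'r) ring_scheme"
  assumes "field K" and "\<one>\<^bsub>K\<^esub> \<oplus>\<^bsub>K\<^esub> \<one>\<^bsub>K\<^esub> \<noteq> \<zero>\<^bsub>K\<^esub>"
  shows
    "(\<forall>(L :: ('k, 'b, 'm) hom_lie_scheme) \<kappa> lam.
        hom_lie_algebra K L \<and>
        linear_map K L L \<kappa> \<and> linear_map K L L lam \<and>
        commutes_with_twist L \<kappa> \<and> commutes_with_twist L lam \<and>
        lie_compatible L \<kappa> lam \<longrightarrow>
        (\<forall>r\<in>carrier L.
          hom_lie_affgebra K (affgebra_of K L \<kappa> lam r) \<and>
          (tw_multiplicative L \<and> lie_tw L r = r \<longrightarrow>
            multiplicative_hom_lie_affgebra K (affgebra_of K L \<kappa> lam r)) \<and>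
          (\<forall>u\<in>carrier (affgebra_of K L \<kappa> lam r).
            aff_tw (affgebra_of K L \<kappa> lam r) u = u \<longrightarrow>
            hom_lie_iso K (fibre (affgebra_of K L \<kappa> lam r) u) L)))
     \<and>
     (\<forall>(A :: ('k, 'a, 'n) hom_lie_aff_scheme) u.
        multiplicative_hom_lie_affgebra K A \<and> u \<in> carrier A \<and> aff_tw A u = u \<longrightarrow>
        hom_lie_algebra K (fibre A u) \<and> tw_multiplicative (fibre A u) \<and>
        (\<exists>\<kappa> lam r.
          linear_map K (fibre A u) (fibre A u) \<kappa> \<and> linear_map K (fibre A u) (fibre A u) lam \<and>
          commutes_with_twist (fibre A u) \<kappa> \<and> commutes_with_twist (fibre A u) lam \<and>
          lie_compatible (fibre A u) \<kappa> lam \<and>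
          r \<in> carrier (fibre A u) \<and> lie_tw (fibre A u) r = r \<and>
          same_hom_lie_affgebra K A (affgebra_of K (fibre A u) \<kappa> lam r)) \<and>
        (\<forall>\<kappa> lam r.
          linear_map K (fibre A u) (fibre A u) \<kappa> \<and> linear_map K (fibre A u) (fibre A u) lam \<and>
          r \<in> carrier (fibre A u) \<and>
          same_hom_lie_affgebra K A (affgebra_of K (fibre A u) \<kappa> lam r) \<longrightarrow>
          lie_compatible (fibre A u) \<kappa> lam))"
proof (intro conjI allI impI ballI; (elim conjE)?)
  fix L :: "('k, 'b, 'm) hom_lie_scheme" and \<kappa> lam r
  assume L: "hom_lie_algebra K L" and lin: "linear_map K L L \<kappa>" "linear_map K L L lam"
    and comm: "commutes_with_twist L \<kappa>" "commutes_with_twist L lam"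
    and compat: "lie_compatible L \<kappa> lam" and r: "r \<in> carrier L"
  let ?A = "affgebra_of K L \<kappa> lam r"
  interpret L: hom_lie_algebra K L by fact
  interpret P: affgebra_presentation K L ?A \<kappa> lam r
    using L.br_linear_left L.br_linear_right L.tw_linear lin r
    by (intro affgebra_presentation.intro affgebra_presentation_axioms.intro L.vectorspace_axioms)
      (simp_all add: same_hom_lie_affgebra_def)
  show A: "hom_lie_affgebra K ?A"
    using P.hom_lie_affgebra_iff[OF assms(2)] L compat by blast
  show "multiplicative_hom_lie_affgebra K ?A" if "tw_multiplicative L" "lie_tw L r = r"
    using P.multiplicative_iff A that comm by blast
  fix u assume u: "u \<in> carrier ?A" "aff_tw ?A u = u"
  interpret pointed_affgebra K ?A u
    using A u by (intro pointed_affgebra.intro pointed_affgebra_axioms.intro)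
  obtain \<kappa>' lam' r' where P': "affgebra_presentation K (fibre ?A u) ?A \<kappa>' lam' r'"
    using fibre_presentation by blast
  have "hom_lie_algebra K (fibre ?A u)"
    using affgebra_presentation.hom_lie_affgebra_iff[OF P' assms(2)] A by blast
  then show "hom_lie_iso K (fibre ?A u) L"
    using P.fibre_iso L u by simp
next
  fix A :: "('k, 'a, 'n) hom_lie_aff_scheme" and u
  assume mult: "multiplicative_hom_lie_affgebra K A" and u: "u \<in> carrier A" "aff_tw A u = u"
  have A: "hom_lie_affgebra K A"
    using mult by (rule multiplicative_hom_lie_affgebra.axioms)
  interpret pointed_affgebra K A u
    using A u by (intro pointed_affgebra.intro pointed_affgebra_axioms.intro)
  have lie: "hom_lie_algebra K (fibre A u)" "lie_compatible (fibre A u) \<kappa> lam"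
    and tw: "tw_multiplicative (fibre A u)" "lie_tw (fibre A u) r = r"
      "commutes_with_twist (fibre A u) \<kappa>" "commutes_with_twist (fibre A u) lam"
    if "affgebra_presentation K (fibre A u) A \<kappa> lam r" for \<kappa> lam r
    using affgebra_presentation.hom_lie_affgebra_iff[OF that assms(2)]
      affgebra_presentation.multiplicative_iff[OF that] A mult by blast+
  obtain \<kappa> lam r where P: "affgebra_presentation K (fibre A u) A \<kappa> lam r"
    using fibre_presentation by blast
  show "hom_lie_algebra K (fibre A u)" "tw_multiplicative (fibre A u)"
    using lie tw P by blast+
  show "\<exists>\<kappa> lam r.
      linear_map K (fibre A u) (fibre A u) \<kappa> \<and> linear_map K (fibre A u) (fibre A u) lam \<and>
      commutes_with_twist (fibre A u) \<kappa> \<and> commutes_with_twist (fibre A u) lam \<and>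
      lie_compatible (fibre A u) \<kappa> lam \<and>
      r \<in> carrier (fibre A u) \<and> lie_tw (fibre A u) r = r \<and>
      same_hom_lie_affgebra K A (affgebra_of K (fibre A u) \<kappa> lam r)"
    using P presentation_iff lie(2)[OF P] tw[OF P] by blast
  show "lie_compatible (fibre A u) \<kappa> lam"
    if "linear_map K (fibre A u) (fibre A u) \<kappa>" "linear_map K (fibre A u) (fibre A u) lam"
      "r \<in> carrier (fibre A u)"
      "same_hom_lie_affgebra K A (affgebra_of K (fibre A u) \<kappa> lam r)" for \<kappa> lam r
    using that presentation_iff lie(2) by blast
qed

end
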